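(* Let $n,m,k\in\mathbb N_0$. Then $S(n,m,k)$ counts the number of car parking assignments of $m$ cars on $n$ spaces such that at least $k$ cars do not find a parking space, that is, $$S(n,m,k)=\sum_{j=k}^m \mathrm{cp}(n,m,j).$$ Equivalently, the car parking numbers $\mathrm{cp}(n,m,k)$ are given by $$\mathrm{cp}(n,m,k)=S(n,m,k)-S(n,m,k+1).$$
   Context: Car parking problem: a car park has $n$ spaces in a line, numbered $1,\dots,n$, and $m$ drivers arrive one after the other. Each driver has chosen a preferred space, so an assignment is a function $f:\{1,\dots,m\}\to\{1,\dots,n\}$, and there are $n^m$ assignments. Each arriving driver parks in the chosen space if it is free; otherwise the driver takes the first free space with a larger number, if there is one; if there is none, the driver fails to park and goes home. For $n,m,k\in\mathbb N_0$, $\mathrm{cp}(n,m,k)$ denotes the number of assignments for which exactly $k$ drivers fail to park. (For $n=0$ there is exactly one assignment if $m=0$ and none if $m>0$.) For $n,m,k\in\mathbb N_0$ define $$S(n,m,k)=\begin{cases} n^m & \text{if } k\le m-n,\\ \displaystyle\sum_{i=0}^{m-k}\binom{m}{i}\,(n-m+k)\,(n-m+k+i)^{i-1}\,(m-k-i)^{m-i} & \text{otherwise.}\end{cases}$$ Here $0^0=1$, and an empty sum (when $k>m$) is $0$; for $i=0$ the factor $(n-m+k)(n-m+k+i)^{i-1}$ equals $1$. *)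

theory Defs
  imports Complex_Main "HOL-Library.FuncSet"
begin

definition assignments :: "nat \<Rightarrow> nat \<Rightarrow> (nat \<Rightarrow> nat) set" where
  "assignments n m = {1..m} \<rightarrow>\<^sub>E {1..n}"

(* The space taken by a driver who prefers space p when the spaces in A are
   occupied; None if the driver fails to park. *)
definition parking_space :: "nat \<Rightarrow> nat set \<Rightarrow> nat \<Rightarrow> nat option" where
  "parking_space n A p =
     (if p \<notin> A then Some p
      else if \<exists>s. p < s \<and> s \<le> n \<and> s \<notin> A then Some (LEAST s. p < s \<and> s \<le> n \<and> s \<notin> A)
      else None)"

(* The set of spaces occupied after drivers 1, ..., i have arrived. *)
primrec occupied :: "nat \<Rightarrow> (nat \<Rightarrow> nat) \<Rightarrow> nat \<Rightarrow> nat set" where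
  "occupied n f 0 = {}"
| "occupied n f (Suc i) =
     (case parking_space n (occupied n f i) (f (Suc i)) of
        None \<Rightarrow> occupied n f i
      | Some s \<Rightarrow> insert s (occupied n f i))"

definition failing_drivers :: "nat \<Rightarrow> nat \<Rightarrow> (nat \<Rightarrow> nat) \<Rightarrow> nat set" where
  "failing_drivers n m f =
     {i \<in> {1..m}. parking_space n (occupied n f (i - 1)) (f i) = None}"

definition cp :: "nat \<Rightarrow> nat \<Rightarrow> nat \<Rightarrow> nat" where
  "cp n m k = card {f \<in> assignments n m. card (failing_drivers n m f) = k}"

(* The condition k + n \<le> m is k \<le> m - n without truncated subtraction. The index
   set {i. i + k \<le> m} is {0..m - k} for k \<le> m and empty for k > m, where the
   truncated {0..m - k} would be {0}. In the second case n - m + k > 0, so the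
   exponent -1 at i = 0 is applied to a positive base and the factor
   (n - m + k) * (n - m + k + i) powi (i - 1) is 1 there. *)
definition S :: "nat \<Rightarrow> nat \<Rightarrow> nat \<Rightarrow> rat" where
  "S n m k =
     (if k + n \<le> m then of_nat (n ^ m)
      else \<Sum>i | i + k \<le> m.
             of_nat (m choose i)
             * (of_nat n - of_nat m + of_nat k)
             * (of_nat n - of_nat m + of_nat k + of_nat i) powi (int i - 1)
             * (of_nat m - of_nat k - of_nat i) ^ (m - i))"

end

theory Submission
  imports Defs
begin

text \<open>
  Put \<open>a = n + k - m\<close>. The number of free spaces at the end is \<open>n - m\<close> plus the number of failures,
  so at least \<open>k\<close> drivers fail iff at least \<open>a\<close> spaces stay free. For \<open>k + n \<le> m\<close> this always holds,
  and all \<open>n ^ m\<close> assignments count.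

  For \<open>a > 0\<close>, classify the assignments by the position \<open>a + i\<close> of the \<open>a\<close>-th space that stays
  free. Nobody drives past it, so exactly \<open>i\<close> drivers prefer the spaces up to it, and they
  all park before it, without choosing the space \<open>a + i\<close> itself. Thus their preferences form a parking
  function for \<open>i\<close> drivers on \<open>a + i - 1\<close> spaces. The other \<open>m - i\<close> drivers choose arbitrarily
  among the \<open>n - a - i = m - k - i\<close> spaces beyond. Since there are
  \<open>a * (a + i) ^ (i - 1)\<close> such parking functions (\<open>card_parking_functions\<close>) and \<open>m choose i\<close> ways
  to select the drivers, the sum defining \<open>S n m k\<close> results.

  The parking process enters only through \<open>le_card_failing_drivers_iff\<close>: whatever the order of
  arrival, the number of failures is the maximal excess of drivers over spaces in an end segment.
  Read from the left, the \<open>a\<close>-th free space is the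
  first \<open>t\<close> such that \<open>t\<close> exceeds by \<open>a\<close> the number of drivers who prefer one of \<open>1, ..., t\<close>.

  The count of parking functions is obtained by induction, sorting them by the set of drivers who
  prefer the first space. Deleting that space and these drivers leaves an object of the same kind,
  and the closed form then reduces to the binomial theorem.
\<close>

section \<open>Counting failures by overfull end segments\<close>

lemma card_filter_Suc:
  "card {j \<in> {1..Suc i}. P j} = card {j \<in> {1..i}. P j} + of_bool (P (Suc i))"
proof -
  have "{j \<in> {1..Suc i}. P j} = (if P (Suc i) then {Suc i} else {}) \<union> {j \<in> {1..i}. P j}"
    by (auto simp: le_Suc_eq)
  then show ?thesis by simp
qed

lemma parking_space_eq_None_iff:
  "parking_space n A p = None \<longleftrightarrow> p \<in> A \<and> (\<forall>s. p < s \<and> s \<le> n \<longrightarrow> s \<in> A)"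
  by (auto simp: parking_space_def)

lemma parking_space_eq_Some:
  assumes "parking_space n A p = Some s" "p \<le> n"
  shows "s \<notin> A \<and> p \<le> s \<and> s \<le> n \<and> (\<forall>r. p \<le> r \<and> r < s \<longrightarrow> r \<in> A)"
proof (cases "p \<in> A")
  case False
  then show ?thesis using assms by (auto simp: parking_space_def)
next
  case True
  let ?Q = "\<lambda>s. p < s \<and> s \<le> n \<and> s \<notin> A"
  have ex: "\<exists>s. ?Q s" and s: "s = (LEAST s. ?Q s)"
    using assms True by (auto simp: parking_space_def split: if_splits)
  have "?Q s" unfolding s using LeastI_ex[OF ex] .
  moreover have "r \<in> A" if "p \<le> r" "r < s" for r
    using not_less_Least[of r ?Q] that True \<open>?Q s\<close> unfolding s[symmetric] by force
  ultimately show ?thesis by auto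
qed

lemma occupied_subset:
  assumes "f \<in> {1..i} \<rightarrow> {1..n}"
  shows "occupied n f i \<subseteq> {1..n}"
  using assms
proof (induction i)
  case (Suc i)
  then have IH: "occupied n f i \<subseteq> {1..n}" by (auto simp: Pi_iff)
  have "1 \<le> f (Suc i)" "f (Suc i) \<le> n" using Suc.prems by (auto simp: Pi_iff)
  with IH show ?case
    using parking_space_eq_Some[of n "occupied n f i" "f (Suc i)"] by (auto split: option.split)
qed simp

lemma card_failing_drivers_Suc:
  "card (failing_drivers n (Suc i) f) =
     card (failing_drivers n i f)
       + of_bool (parking_space n (occupied n f i) (f (Suc i)) = None)"
  unfolding failing_drivers_def card_filter_Suc by simp

text \<open>
  A driver who prefers a space beyond \<open>t\<close> either parks beyond \<open>t\<close> or fails, which gives the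
  inequality. If \<open>t\<close> is still free, then no driver who prefers one of \<open>1, ..., t\<close> has driven
  past it, so that none of them fails or parks beyond \<open>t\<close>, and equality holds. The value \<open>t = 0\<close> is
  admitted as a space that is always free.
\<close>
lemma card_preferring_beyond:
  assumes "f \<in> {1..i} \<rightarrow> {1..n}"
  shows "card {j \<in> {1..i}. t < f j}
           \<le> card (occupied n f i \<inter> {t<..n}) + card (failing_drivers n i f)"
    and "t \<le> n \<Longrightarrow> t \<notin> occupied n f i \<Longrightarrow>
         card {j \<in> {1..i}. t < f j}
           = card (occupied n f i \<inter> {t<..n}) + card (failing_drivers n i f)"
proof -
  have "card {j \<in> {1..i}. t < f j}
           \<le> card (occupied n f i \<inter> {t<..n}) + card (failing_drivers n i f) \<and>
        (t \<le> n \<longrightarrow> t \<notin> occupied n f i \<longrightarrow>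
         card {j \<in> {1..i}. t < f j}
           = card (occupied n f i \<inter> {t<..n}) + card (failing_drivers n i f))"
    using assms
  proof (induction i)
    case 0
    then show ?case by (simp add: failing_drivers_def)
  next
    case (Suc i)
    let ?A = "occupied n f i" and ?p = "f (Suc i)"
    have f: "f \<in> {1..i} \<rightarrow> {1..n}" using Suc.prems by (auto simp: Pi_iff)
    have p: "?p \<le> n" using Suc.prems by (auto simp: Pi_iff)
    note IH = Suc.IH[OF f]
    show ?case
    proof (cases "parking_space n ?A ?p")
      case None
      then have "t \<le> n \<Longrightarrow> t \<notin> ?A \<Longrightarrow> t < ?p"
        unfolding parking_space_eq_None_iff by (metis linorder_neqE_nat)
      then show ?thesis
        using IH None unfolding card_filter_Suc card_failing_drivers_Suc by auto
    next
      case (Some s)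
      note s = parking_space_eq_Some[OF Some p]
      have "finite ?A" using occupied_subset[OF f] finite_subset by blast
      then have "card (insert s ?A \<inter> {t<..n}) = card (?A \<inter> {t<..n}) + of_bool (t < s)"
        using s by (auto simp: Int_insert_left)
      moreover have "t < ?p \<Longrightarrow> t < s" using s by linarith
      moreover have "t \<notin> ?A \<Longrightarrow> t < s \<Longrightarrow> t < ?p" using s by (meson not_le)
      ultimately show ?thesis
        using IH Some unfolding card_filter_Suc card_failing_drivers_Suc by auto
    qed
  qed
  then show "card {j \<in> {1..i}. t < f j}
           \<le> card (occupied n f i \<inter> {t<..n}) + card (failing_drivers n i f)"
    and "t \<le> n \<Longrightarrow> t \<notin> occupied n f i \<Longrightarrow>
         card {j \<in> {1..i}. t < f j}
           = card (occupied n f i \<inter> {t<..n}) + card (failing_drivers n i f)"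
    by auto
qed

text \<open>
  The number of failures is the largest excess of an end segment: the number of drivers who prefer
  a space in it minus its length. The maximum is attained where the segment begins just after the
  last space that stays free, or at space \<open>1\<close> if there is none.
\<close>
lemma le_card_failing_drivers_iff:
  assumes "f \<in> assignments n m"
  shows "k \<le> card (failing_drivers n m f) \<longleftrightarrow>
         (\<exists>t\<le>n. n - t + k \<le> card {j \<in> {1..m}. t < f j})"
proof -
  have f: "f \<in> {1..m} \<rightarrow> {1..n}" using assms by (auto simp: assignments_def)
  show ?thesis
  proof
    assume k: "k \<le> card (failing_drivers n m f)"
    let ?free = "\<lambda>t. t \<le> n \<and> t \<notin> occupied n f m"
    have "?free 0" using occupied_subset[OF f] by auto
    then have ex: "?free (Greatest ?free)" and
      max: "\<And>t. ?free t \<Longrightarrow> t \<le> Greatest ?free"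
      using GreatestI_nat[of ?free 0 n] Greatest_le_nat[of ?free _ n] by blast+
    let ?t = "Greatest ?free"
    have "occupied n f m \<inter> {?t<..n} = {?t<..n}" using max by fastforce
    then have "card {j \<in> {1..m}. ?t < f j} = n - ?t + card (failing_drivers n m f)"
      using card_preferring_beyond(2)[OF f] ex by simp
    then show "\<exists>t\<le>n. n - t + k \<le> card {j \<in> {1..m}. t < f j}"
      using k ex by (intro exI[of _ ?t]) simp
  next
    assume "\<exists>t\<le>n. n - t + k \<le> card {j \<in> {1..m}. t < f j}"
    then obtain t where "n - t + k \<le> card {j \<in> {1..m}. t < f j}" by blast
    moreover have "card (occupied n f m \<inter> {t<..n}) \<le> n - t"
      using card_mono[of "{t<..n}" "occupied n f m \<inter> {t<..n}"] by simp
    ultimately show "k \<le> card (failing_drivers n m f)"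
      using card_preferring_beyond(1)[OF f, of t] by linarith
  qed
qed

text \<open>
  The same criterion read from the left: by counting, the end segment beyond \<open>t\<close> has an excess of
  \<open>k\<close> drivers iff the initial segment up to \<open>t\<close> has an excess of \<open>a = n + k - m\<close> spaces.
\<close>
lemma le_card_failing_drivers_iff_initial:
  assumes "f \<in> assignments n m" and a: "n + k = m + a"
  shows "k \<le> card (failing_drivers n m f) \<longleftrightarrow>
         (\<exists>t\<le>n. a + card {j \<in> {1..m}. f j \<le> t} \<le> t)"
proof -
  have "n - t + k \<le> card {j \<in> {1..m}. t < f j} \<longleftrightarrow> a + card {j \<in> {1..m}. f j \<le> t} \<le> t"
    if "t \<le> n" for t
  proof -
    have "{1..m} = {j \<in> {1..m}. f j \<le> t} \<union> {j \<in> {1..m}. t < f j}" by auto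
    moreover have "card ({j \<in> {1..m}. f j \<le> t} \<union> {j \<in> {1..m}. t < f j}) =
                   card {j \<in> {1..m}. f j \<le> t} + card {j \<in> {1..m}. t < f j}"
      by (rule card_Un_disjoint) auto
    ultimately have "m = card {j \<in> {1..m}. f j \<le> t} + card {j \<in> {1..m}. t < f j}"
      by (metis card_atLeastAtMost diff_Suc_1)
    then show ?thesis using a that by linarith
  qed
  then show ?thesis using le_card_failing_drivers_iff[OF assms(1)] by auto
qed

section \<open>Counting by subsets of the drivers\<close>

lemma card_restrict_pair:
  assumes "J \<subseteq> D" "X \<subseteq> extensional J" "Y \<subseteq> extensional (D - J)"
  shows "card {f \<in> extensional D. restrict f J \<in> X \<and> restrict f (D - J) \<in> Y} = card X * card Y"
proof -
  let ?F = "{f \<in> extensional D. restrict f J \<in> X \<and> restrict f (D - J) \<in> Y}"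
  let ?glue = "\<lambda>(g, h) x. if x \<in> J then g x else h x"
  have glue: "restrict (?glue (g, h)) J = g" "restrict (?glue (g, h)) (D - J) = h"
      "?glue (g, h) \<in> extensional D" if "g \<in> X" "h \<in> Y" for g h
    using that assms by (fastforce simp: restrict_def extensional_def)+
  have "bij_betw (\<lambda>f. (restrict f J, restrict f (D - J))) ?F (X \<times> Y)"
  proof (rule bij_betw_byWitness[where f' = ?glue])
    show "\<forall>f\<in>?F. ?glue (restrict f J, restrict f (D - J)) = f"
      using assms(1) by (auto simp: restrict_def extensional_def fun_eq_iff)
    show "\<forall>p\<in>X \<times> Y. (restrict (?glue p) J, restrict (?glue p) (D - J)) = p"
      using glue by (metis (no_types, lifting) SigmaE)
    show "(\<lambda>f. (restrict f J, restrict f (D - J))) ` ?F \<subseteq> X \<times> Y" by auto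
    show "?glue ` (X \<times> Y) \<subseteq> ?F" using glue by auto
  qed
  then show ?thesis by (simp add: bij_betw_same_card card_cartesian_product)
qed

lemma sum_Pow_card:
  fixes g :: "nat \<Rightarrow> 'a :: comm_semiring_1"
  assumes "finite D"
  shows "(\<Sum>J\<in>Pow D. g (card J)) = (\<Sum>i\<le>card D. of_nat (card D choose i) * g i)"
proof -
  have "(\<Sum>J\<in>Pow D. g (card J)) = (\<Sum>i\<le>card D. \<Sum>J | J \<in> Pow D \<and> card J = i. g (card J))"
    using assms by (intro sum.group[symmetric]) (auto intro: card_mono)
  also have "\<dots> = (\<Sum>i\<le>card D. of_nat (card D choose i) * g i)"
    using n_subsets[OF assms] by (intro sum.cong) (auto simp: Pow_def)
  finally show ?thesis .
qed

section \<open>Parking functions\<close>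

text \<open>
  For \<open>a > 0\<close> and up to the offset \<open>c\<close>, these are the assignments of the drivers in \<open>D\<close> to
  \<open>a + card D - 1\<close> spaces for which everybody parks: the condition bounds the number of drivers
  who prefer a space beyond \<open>s\<close> by \<open>a + card D - 1 - s\<close>. The value \<open>a + card D\<close> is allowed in
  the codomain, but the condition for \<open>s = a + card D - 1\<close> excludes it. In this form,
  \<open>a + card D\<close> is the first \<open>s\<close> for which \<open>s - card {x \<in> D. f x \<le> c + s}\<close> reaches \<open>a\<close>, and for
  \<open>a = 0\<close>, to which the recursion below descends, there is no such function unless \<open>D = {}\<close>.
  The offset lets that recursion drop the first space without renumbering.
\<close>
definition parking_functions :: "nat \<Rightarrow> nat \<Rightarrow> 'a set \<Rightarrow> ('a \<Rightarrow> nat) set" where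
  "parking_functions c a D =
     {f \<in> D \<rightarrow>\<^sub>E {c<..c + a + card D}.
        \<forall>s < a + card D. s < a + card {x \<in> D. f x \<le> c + s}}"

lemma parking_functions_extensional: "parking_functions c a D \<subseteq> extensional D"
  by (auto simp: parking_functions_def PiE_iff)

lemma finite_parking_functions: "finite D \<Longrightarrow> finite (parking_functions c a D)"
  unfolding parking_functions_def
  by (rule finite_subset[of _ "D \<rightarrow>\<^sub>E {c<..c + a + card D}"]) (auto intro: finite_PiE)

text \<open>
  Sort by the set \<open>J\<close> of drivers who prefer the first space. Removing these drivers together with
  that space changes the excess of spaces over drivers by \<open>card J - 1\<close>.
\<close>
lemma card_parking_functions_rec:
  assumes "finite D"
  shows "card (parking_functions c (Suc a) D) =
         (\<Sum>J\<in>Pow D. card (parking_functions (Suc c) (a + card J) (D - J)))"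
proof -
  let ?P = "parking_functions c (Suc a) D"
  let ?Q = "\<lambda>J. parking_functions (Suc c) (a + card J) (D - J)"
  define F where "F J = {f \<in> ?P. {x \<in> D. f x = Suc c} = J}" for J
  have card_F: "card (F J) = card (?Q J)" if "J \<subseteq> D" for J
  proof -
    have fin: "finite J" using that assms by (rule finite_subset)
    then have cD: "card J + card (D - J) = card D"
      using that assms by (simp add: card_Diff_subset card_mono)
    have count: "card {x \<in> D. f x \<le> c + Suc s} =
                 card J + card {x \<in> D - J. restrict f (D - J) x \<le> Suc c + s}"
      if "\<forall>x\<in>J. f x = Suc c" for f s
    proof -
      have "{x \<in> D. f x \<le> c + Suc s} = J \<union> {x \<in> D - J. restrict f (D - J) x \<le> Suc c + s}"
        using that \<open>J \<subseteq> D\<close> by auto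
      then show ?thesis using fin assms by (simp add: card_Un_disjoint disjoint_iff)
    qed
    have shift: "(\<forall>s < Suc a + card D. s < Suc a + card {x \<in> D. f x \<le> c + s}) \<longleftrightarrow>
          (\<forall>s < a + card J + card (D - J).
              s < a + card J + card {x \<in> D - J. restrict f (D - J) x \<le> Suc c + s})"
      if "\<forall>x\<in>J. f x = Suc c" for f
    proof -
      have "(\<forall>s < Suc a + card D. s < Suc a + card {x \<in> D. f x \<le> c + s}) \<longleftrightarrow>
            (\<forall>s < a + card D. Suc s < Suc a + card {x \<in> D. f x \<le> c + Suc s})"
        using less_Suc_eq_0_disj by auto
      then show ?thesis using count[OF that] cD by (simp add: add.assoc)
    qed
    have "F J = {f \<in> extensional D. restrict f J \<in> (J \<rightarrow>\<^sub>E {Suc c}) \<and> restrict f (D - J) \<in> ?Q J}"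
      (is "_ = ?G")
    proof (rule set_eqI)
      fix f
      have J: "\<forall>x\<in>J. f x = Suc c" if "f \<in> F J \<or> restrict f J \<in> (J \<rightarrow>\<^sub>E {Suc c})"
      proof
        fix x assume "x \<in> J"
        from that show "f x = Suc c"
        proof
          assume "f \<in> F J"
          then show "f x = Suc c" using \<open>x \<in> J\<close> unfolding F_def by blast
        next
          assume "restrict f J \<in> (J \<rightarrow>\<^sub>E {Suc c})"
          then have "restrict f J x \<in> {Suc c}" using \<open>x \<in> J\<close> by (rule PiE_mem)
          then show "f x = Suc c" using \<open>x \<in> J\<close> by simp
        qed
      qed
      have B: "{Suc c<..Suc c + (a + card J) + card (D - J)} = {Suc c<..c + Suc a + card D}"
        using cD by auto
      show "f \<in> F J \<longleftrightarrow> f \<in> ?G"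
      proof (cases "\<forall>x\<in>J. f x = Suc c")
        case True
        let ?B = "{c<..c + Suc a + card D}" and ?B' = "{Suc c<..c + Suc a + card D}"
        have "f \<in> D \<rightarrow>\<^sub>E ?B \<and> {x \<in> D. f x = Suc c} = J \<longleftrightarrow>
              f \<in> extensional D \<and> (\<forall>x\<in>D - J. f x \<in> ?B')" (is "?l \<longleftrightarrow> ?r")
        proof
          assume l: ?l
          have "f x \<in> ?B'" if "x \<in> D - J" for x
          proof -
            have "f x \<in> ?B" "f x \<noteq> Suc c" using l that by blast+
            then show ?thesis by simp
          qed
          then show ?r using l by (auto simp: PiE_iff)
        next
          assume r: ?r
          have "f x \<in> ?B \<and> (f x = Suc c \<longleftrightarrow> x \<in> J)" if "x \<in> D" for x
          proof (cases "x \<in> J")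
            case False
            then have "f x \<in> ?B'" using r that by blast
            then show ?thesis using False by simp
          qed (use True in simp)
          then show ?l using r \<open>J \<subseteq> D\<close> by (auto simp: PiE_iff)
        qed
        also have "(\<forall>x\<in>D - J. f x \<in> ?B') \<longleftrightarrow> restrict f (D - J) \<in> (D - J) \<rightarrow>\<^sub>E ?B'"
          by (simp add: PiE_iff)
        finally have "f \<in> D \<rightarrow>\<^sub>E ?B \<and> {x \<in> D. f x = Suc c} = J \<longleftrightarrow>
              f \<in> extensional D \<and> restrict f (D - J) \<in> (D - J) \<rightarrow>\<^sub>E ?B'" .
        moreover have "restrict f J \<in> J \<rightarrow>\<^sub>E {Suc c}" using True by (auto simp: PiE_iff)
        ultimately show ?thesis
          unfolding F_def parking_functions_def B mem_Collect_eq using shift[OF True] by blast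
      next
        case False
        then show ?thesis using J by blast
      qed
    qed
    moreover have "J \<rightarrow>\<^sub>E {Suc c} \<subseteq> extensional J" by (metis PiE_iff subsetI)
    ultimately have "card (F J) = card (J \<rightarrow>\<^sub>E {Suc c}) * card (?Q J)"
      by (simp only: card_restrict_pair[OF that _ parking_functions_extensional])
    then show ?thesis using fin by (simp add: card_PiE)
  qed
  have "?P = (\<Union>J\<in>Pow D. F J)" by (auto simp: F_def)
  then have "card ?P = (\<Sum>J\<in>Pow D. card (F J))"
    using assms finite_parking_functions[OF assms]
    by (simp only:) (intro card_UN_disjoint; auto simp: F_def)
  then show ?thesis using card_F by simp
qed

lemma sum_choose_times_index:
  fixes N :: nat
  shows "(\<Sum>j\<le>d. (d choose j) * j * N ^ (d - j)) = d * (N + 1) ^ (d - 1)"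
proof (cases d)
  case (Suc e)
  have "(\<Sum>j\<le>d. (d choose j) * j * N ^ (d - j)) = (\<Sum>j\<le>e. (d choose Suc j) * Suc j * N ^ (e - j))"
    unfolding Suc by (subst sum.atMost_Suc_shift) simp
  also have "\<dots> = (\<Sum>j\<le>e. d * ((e choose j) * N ^ (e - j)))"
    unfolding Suc by (intro sum.cong refl) (metis Suc_times_binomial_eq mult.assoc)
  also have "\<dots> = d * (N + 1) ^ e"
    using binomial_ring[of 1 N e] by (simp add: sum_distrib_left add.commute)
  finally show ?thesis using Suc by simp
qed simp

text \<open>
  For \<open>a > 0\<close> the number is \<open>a * (a + d) ^ (d - 1)\<close> with \<open>d = card D\<close>; the factor \<open>a + d\<close> on the left keeps the
  exponent a natural number when \<open>d = 0\<close>. In the recursion all terms have the same sum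
  \<open>N = a + d - 1\<close> of parameter and number of drivers, so that the closed form turns the right-hand
  side into a binomial sum over powers of \<open>N\<close>. The induction hypothesis gives each term only up to
  the factor \<open>N\<close>, so the case \<open>a = 1\<close>, \<open>d = 0\<close>, where \<open>N = 0\<close>, has to be computed directly.
\<close>
lemma card_parking_functions:
  assumes "finite D"
  shows "card (parking_functions c a D) * (a + card D) = a * (a + card D) ^ card D"
  using assms
proof (induction "a + card D" arbitrary: a c D rule: less_induct)
  case less
  show ?case
  proof (cases "D = {} \<or> a = 0")
    case True
    have "card (parking_functions c a {}) = 1"
      by (simp add: parking_functions_def cong: conj_cong)
    moreover have "parking_functions c 0 D = {}" if "D \<noteq> {}"
    proof -
      have "card {x \<in> D. f x \<le> c} = 0" if "f \<in> D \<rightarrow>\<^sub>E {c<..c + card D}" for f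
        using that by (auto simp: PiE_iff card_eq_0_iff)
      moreover have "0 < card D" using that less.prems by (simp add: card_gt_0_iff)
      ultimately show ?thesis unfolding parking_functions_def by fastforce
    qed
    ultimately show ?thesis using True by (cases "D = {}") auto
  next
    case False
    then obtain b where a: "a = Suc b" by (cases a) auto
    define d where "d = card D"
    define N where "N = b + d"
    have "N > 0" using False less.prems by (simp add: N_def d_def card_gt_0_iff)
    have IH: "card (parking_functions (Suc c) (b + card J) (D - J)) * N = (b + card J) * N ^ (d - card J)"
      if "J \<in> Pow D" for J
    proof -
      have "finite J" using that less.prems finite_subset by blast
      then have cD: "card (D - J) = d - card J" "card J \<le> d"
        using that less.prems by (simp_all add: card_Diff_subset card_mono d_def)
      then have N: "b + card J + card (D - J) = N" by (simp add: N_def)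
      then have "b + card J + card (D - J) < a + card D" by (simp add: a N_def d_def)
      from less.hyps[OF this, of "Suc c"] show ?thesis using less.prems N cD by simp
    qed
    have "card (parking_functions c a D) * N = (\<Sum>J\<in>Pow D. (b + card J) * N ^ (d - card J))"
      unfolding a card_parking_functions_rec[OF less.prems] sum_distrib_right
      using IH by (rule sum.cong[OF refl])
    also have "\<dots> = (\<Sum>j\<le>d. (d choose j) * ((b + j) * N ^ (d - j)))"
      using sum_Pow_card[OF less.prems, of "\<lambda>j. (b + j) * N ^ (d - j)"] by (simp add: d_def)
    also have "\<dots> = b * (\<Sum>j\<le>d. (d choose j) * N ^ (d - j)) + (\<Sum>j\<le>d. (d choose j) * j * N ^ (d - j))"
      by (simp add: algebra_simps sum.distrib sum_distrib_left)
    also have "\<dots> = b * (N + 1) ^ d + d * (N + 1) ^ (d - 1)"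
      using binomial_ring[of 1 N d] by (simp add: sum_choose_times_index add.commute)
    finally have "card (parking_functions c a D) * N * (N + 1)
                  = b * (N + 1) * (N + 1) ^ d + d * ((N + 1) ^ (d - 1) * (N + 1))"
      by (simp add: algebra_simps)
    also have "d * ((N + 1) ^ (d - 1) * (N + 1)) = d * (N + 1) ^ d"
      by (cases d) auto
    also have "b * (N + 1) * (N + 1) ^ d + d * (N + 1) ^ d = a * (N + 1) ^ d * N"
      by (simp add: a N_def algebra_simps)
    finally have "N * (card (parking_functions c a D) * (N + 1)) = N * (a * (N + 1) ^ d)"
      by (simp only: mult_ac)
    then have "card (parking_functions c a D) * (N + 1) = a * (N + 1) ^ d"
      using \<open>N > 0\<close> by (metis mult_left_cancel not_gr_zero)
    moreover have "N + 1 = a + card D" by (simp add: a N_def d_def)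
    ultimately show ?thesis by (simp only: d_def)
  qed
qed

section \<open>The number of assignments with at least k failures\<close>

text \<open>
  Let \<open>t\<close> be the first position where spaces exceed drivers by at least \<open>a\<close>. The excess starts
  at \<open>0 < a\<close> and grows by at most \<open>1\<close> per space, so it equals \<open>a\<close> at \<open>t\<close>, which is therefore
  \<open>a + card J\<close> for the set \<open>J\<close> of drivers who prefer one of the first \<open>t\<close> spaces.
\<close>
lemma ex_excess_iff_first_excess:
  fixes f :: "'a \<Rightarrow> nat"
  assumes "finite D" "0 < a"
  shows "(\<exists>t\<le>n. a + card {x \<in> D. f x \<le> t} \<le> t) \<longleftrightarrow>
         (\<exists>J\<subseteq>D. a + card J \<le> n \<and> {x \<in> D. f x \<le> a + card J} = J \<and>
            (\<forall>s < a + card J. s < a + card {x \<in> D. f x \<le> s}))"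
    (is "?L \<longleftrightarrow> ?R")
proof
  let ?hit = "\<lambda>t. a + card {x \<in> D. f x \<le> t} \<le> t"
  assume ?L
  then obtain u where u: "u \<le> n" "?hit u" by blast
  define t where "t = Least ?hit"
  have hit: "?hit t" and below: "\<And>s. s < t \<Longrightarrow> s < a + card {x \<in> D. f x \<le> s}" and "t \<le> n"
    unfolding t_def using LeastI[of ?hit u] Least_le[of ?hit u] not_less_Least[of _ ?hit] u
    by (auto simp: not_le)
  have "t > 0" using hit assms(2) by simp
  then have "t - 1 < a + card {x \<in> D. f x \<le> t - 1}" using below by simp
  also have "card {x \<in> D. f x \<le> t - 1} \<le> card {x \<in> D. f x \<le> t}"
    using assms(1) by (intro card_mono) auto
  finally have "a + card {x \<in> D. f x \<le> t} = t" using hit by simp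
  then show ?R using below \<open>t \<le> n\<close> by (intro exI[of _ "{x \<in> D. f x \<le> t}"]) auto
next
  assume ?R
  then show ?L by (metis order_refl)
qed

text \<open>
  The drivers in \<open>J\<close>, who prefer the first \<open>a + card J\<close> spaces, and the remaining drivers, who
  prefer the other spaces, choose independently of each other.
\<close>
lemma card_first_excess:
  assumes "finite D" "J \<subseteq> D" "a + card J \<le> n"
  shows "card {f \<in> D \<rightarrow>\<^sub>E {1..n}. {x \<in> D. f x \<le> a + card J} = J \<and>
                  (\<forall>s < a + card J. s < a + card {x \<in> D. f x \<le> s})}
         = card (parking_functions 0 a J) * (n - a - card J) ^ (card D - card J)"
    (is "card ?F = _")
proof -
  let ?t = "a + card J"
  have fin: "finite J" using assms finite_subset by blast
  have "?F = {f \<in> extensional D. restrict f J \<in> parking_functions 0 a J \<and>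
                  restrict f (D - J) \<in> (D - J) \<rightarrow>\<^sub>E {?t<..n}}" (is "_ = ?G")
  proof (rule set_eqI)
    fix f
    show "f \<in> ?F \<longleftrightarrow> f \<in> ?G"
    proof (cases "f \<in> D \<rightarrow>\<^sub>E {1..n} \<and> {x \<in> D. f x \<le> ?t} = J")
      case True
      then have "{x \<in> D. f x \<le> s} = {x \<in> J. restrict f J x \<le> 0 + s}" if "s < ?t" for s
        using that by fastforce
      moreover have "\<forall>x\<in>J. 0 < f x \<and> f x \<le> ?t" "\<forall>x\<in>D - J. ?t < f x \<and> f x \<le> n"
        using True by (auto simp: PiE_iff Suc_le_eq)
      then have "f \<in> extensional D" "restrict f J \<in> J \<rightarrow>\<^sub>E {0<..0 + a + card J}"
        "restrict f (D - J) \<in> (D - J) \<rightarrow>\<^sub>E {?t<..n}"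
        using True by (auto simp: PiE_iff)
      ultimately show ?thesis using True unfolding parking_functions_def by auto
    next
      case False
      have "f \<notin> ?G"
      proof
        assume G: "f \<in> ?G"
        then have "\<forall>x\<in>J. 0 < f x \<and> f x \<le> ?t" "\<forall>x\<in>D - J. ?t < f x \<and> f x \<le> n"
          by (auto simp: parking_functions_def PiE_iff)
        then have f: "\<forall>x\<in>D. 1 \<le> f x \<and> f x \<le> n \<and> (f x \<le> ?t \<longleftrightarrow> x \<in> J)"
          using assms(3) by (force simp: Suc_le_eq)
        then have "f \<in> D \<rightarrow>\<^sub>E {1..n}" using G by (auto simp: PiE_iff)
        moreover have "{x \<in> D. f x \<le> ?t} = J" using f assms(2) by auto
        ultimately show False using False by blast
      qed
      then show ?thesis using False by blast
    qed
  qed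
  then have "card ?F = card (parking_functions 0 a J) * card ((D - J) \<rightarrow>\<^sub>E {?t<..n})"
    using card_restrict_pair[OF assms(2), of "parking_functions 0 a J" "(D - J) \<rightarrow>\<^sub>E {?t<..n}"]
      parking_functions_extensional[of 0 a J] by (simp add: PiE_iff subset_iff)
  also have "card ((D - J) \<rightarrow>\<^sub>E {?t<..n}) = (n - a - card J) ^ (card D - card J)"
    using assms fin by (simp add: card_PiE card_Diff_subset)
  finally show ?thesis .
qed

lemma finite_assignments: "finite (assignments n m)"
  unfolding assignments_def by (rule finite_PiE) auto

lemma card_at_least_failures_eq_sum:
  assumes a: "n + k = m + a" "0 < a"
  shows "card {f \<in> assignments n m. k \<le> card (failing_drivers n m f)} =
         (\<Sum>J | J \<subseteq> {1..m} \<and> card J + k \<le> m.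
            card (parking_functions 0 a J) * (m - k - card J) ^ (m - card J))"
proof -
  define F where "F J = {f \<in> {1..m} \<rightarrow>\<^sub>E {1..n}. {x \<in> {1..m}. f x \<le> a + card J} = J \<and>
                  (\<forall>s < a + card J. s < a + card {x \<in> {1..m}. f x \<le> s})}" for J
  let ?I = "{J. J \<subseteq> {1..m} \<and> card J + k \<le> m}"
  have le_n: "a + i \<le> n \<longleftrightarrow> i + k \<le> m" for i using a by linarith
  have eq: "{f \<in> assignments n m. k \<le> card (failing_drivers n m f)} = (\<Union>J\<in>?I. F J)"
  proof (rule set_eqI)
    fix f
    show "f \<in> {f \<in> assignments n m. k \<le> card (failing_drivers n m f)} \<longleftrightarrow> f \<in> (\<Union>J\<in>?I. F J)"
      using le_card_failing_drivers_iff_initial[OF _ a(1), of f]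
        ex_excess_iff_first_excess[of "{1..m}" a n f] a(2)
      unfolding F_def assignments_def by (auto simp: le_n)
  qed
  (* Two sets J and K for the same f both end at the first position with excess a. *)
  have le: "card K \<le> card J" if "f \<in> F J" "f \<in> F K" for f J K
  proof (rule ccontr)
    have J: "{x \<in> {1..m}. f x \<le> a + card J} = J" using that(1) unfolding F_def by blast
    assume "\<not> card K \<le> card J"
    then have "a + card J < a + card K" by simp
    then have "a + card J < a + card {x \<in> {1..m}. f x \<le> a + card J}"
      using that(2) unfolding F_def by blast
    then show False unfolding J by simp
  qed
  have disj: "F J \<inter> F K = {}" if "J \<noteq> K" for J K
  proof (rule ccontr)
    assume "F J \<inter> F K \<noteq> {}"
    then obtain f where f: "f \<in> F J" "f \<in> F K" by blast
    then have "card J = card K" using le by (meson le_antisym)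
    moreover have "{x \<in> {1..m}. f x \<le> a + card J} = J" "{x \<in> {1..m}. f x \<le> a + card K} = K"
      using f unfolding F_def by blast+
    ultimately show False using that by simp
  qed
  have "finite ?I" by (rule finite_subset[of _ "Pow {1..m}"]) auto
  moreover have "finite (F J)" for J
    using finite_assignments[of n m] by (simp add: F_def assignments_def)
  ultimately have "card (\<Union>J\<in>?I. F J) = (\<Sum>J\<in>?I. card (F J))"
    using disj by (intro card_UN_disjoint) auto
  also have "\<dots> = (\<Sum>J\<in>?I. card (parking_functions 0 a J) * (m - k - card J) ^ (m - card J))"
  proof (intro sum.cong refl)
    fix J assume J: "J \<in> ?I"
    then have "a + card J \<le> n" "n - a - card J = m - k - card J" using a le_n by auto
    then show "card (F J) = card (parking_functions 0 a J) * (m - k - card J) ^ (m - card J)"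
      using card_first_excess[of "{1..m}" J a n] J unfolding F_def by simp
  qed
  finally show ?thesis using eq by simp
qed

lemma S_eq_card_at_least_failures:
  "S n m k = of_nat (card {f \<in> assignments n m. k \<le> card (failing_drivers n m f)})"
proof (cases "k + n \<le> m")
  case True
  have "k \<le> card (failing_drivers n m f)" if "f \<in> assignments n m" for f
  proof -
    have "{j \<in> {1..m}. 0 < f j} = {1..m}" using that by (auto simp: assignments_def PiE_iff Suc_le_eq)
    then show ?thesis
      using True le_card_failing_drivers_iff[OF that, of k] by (auto intro!: exI[of _ 0])
  qed
  then have "{f \<in> assignments n m. k \<le> card (failing_drivers n m f)} = assignments n m" by auto
  then show ?thesis using True by (simp add: S_def assignments_def card_PiE)
next
  case False
  define a where "a = n + k - m"
  have a: "n + k = m + a" "0 < a" using False by (auto simp: a_def)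
  have ra: "(of_nat n - of_nat m + of_nat k :: rat) = of_nat a"
    using a(1) by (metis (no_types, lifting) add_diff_cancel_left' diff_add_eq of_nat_add)
  define g :: "nat \<Rightarrow> rat" where
    "g i = of_nat a * of_nat (a + i) powi (int i - 1) * of_nat (m - k - i) ^ (m - i)" for i
  have park: "of_nat (card (parking_functions 0 a J)) =
              (of_nat a * of_nat (a + card J) powi (int (card J) - 1) :: rat)"
    if "finite J" for J :: "nat set"
  proof -
    have "of_nat (card (parking_functions 0 a J)) * of_nat (a + card J) =
          (of_nat a * of_nat (a + card J) ^ card J :: rat)"
      using card_parking_functions[OF that, of 0 a] by (metis of_nat_mult of_nat_power)
    moreover have "(of_nat (a + card J) :: rat) \<noteq> 0" using a(2) by simp
    ultimately show ?thesis
      by (simp add: power_int_diff divide_simps del: of_nat_add)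
  qed
  have "of_nat (card {f \<in> assignments n m. k \<le> card (failing_drivers n m f)}) =
        (\<Sum>J | J \<subseteq> {1..m} \<and> card J + k \<le> m. g (card J))"
    unfolding card_at_least_failures_eq_sum[OF a] of_nat_sum g_def
    by (intro sum.cong refl) (simp add: park finite_subset[of _ "{1..m}"] del: of_nat_add)
  also have "\<dots> = (\<Sum>J\<in>Pow {1..m}. if card J + k \<le> m then g (card J) else 0)"
    by (subst sum.inter_filter[symmetric]) (auto intro!: sum.cong)
  also have "\<dots> = (\<Sum>i\<le>m. of_nat (m choose i) * (if i + k \<le> m then g i else 0))"
    using sum_Pow_card[of "{1..m}" "\<lambda>i. if i + k \<le> m then g i else 0"] by simp
  also have "\<dots> = (\<Sum>i | i + k \<le> m. of_nat (m choose i) * g i)"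
    by (intro sum.mono_neutral_cong_right) auto
  also have "\<dots> = S n m k"
    using False unfolding S_def g_def ra
    by (auto intro!: sum.cong simp: algebra_simps of_nat_diff)
  finally show ?thesis by simp
qed

theorem theorem6:
  fixes n m k :: nat
  shows "S n m k = of_nat (card {f \<in> assignments n m. k \<le> card (failing_drivers n m f)})
       \<and> S n m k = (\<Sum>j = k..m. of_nat (cp n m j))
       \<and> of_nat (cp n m k) = S n m k - S n m (k + 1)"
proof (intro conjI)
  let ?fail = "\<lambda>f. card (failing_drivers n m f)"
  let ?A = "\<lambda>k. {f \<in> assignments n m. k \<le> ?fail f}"
  let ?C = "\<lambda>k. {f \<in> assignments n m. ?fail f = k}"
  show S: "S n m k = of_nat (card (?A k))" by (rule S_eq_card_at_least_failures)
  have "?fail f \<le> m" for f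
  proof -
    have "failing_drivers n m f \<subseteq> {1..m}" by (auto simp: failing_drivers_def)
    then show ?thesis using card_mono[of "{1..m}"] by fastforce
  qed
  then have "?A k = (\<Union>j\<in>{k..m}. ?C j)" by auto
  then have "card (?A k) = (\<Sum>j = k..m. cp n m j)"
    unfolding cp_def using finite_assignments[of n m]
    by (simp only:) (intro card_UN_disjoint; auto)
  then show "S n m k = (\<Sum>j = k..m. of_nat (cp n m j))" using S by simp
  have "?A k = ?C k \<union> ?A (k + 1)" by auto
  moreover have "card (?C k \<union> ?A (k + 1)) = card (?C k) + card (?A (k + 1))"
    using finite_assignments[of n m] by (intro card_Un_disjoint) auto
  ultimately have "card (?A k) = cp n m k + card (?A (k + 1))" by (simp only: cp_def)
  then show "of_nat (cp n m k) = S n m k - S n m (k + 1)"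
    unfolding S_eq_card_at_least_failures by simp
qed

end
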